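(* Let $A\subset\mathbb{N}_0$ be a finite 3-free set, let $S(A)$ be the Stanley sequence generated by $A$, and let $S(A,x)=|\{s\in S(A): s\le x\}|$ be its counting function. Then for every $\epsilon>0$ there exists $x_0(\epsilon,A)$ such that for all $x\ge x_0(\epsilon,A)$, \[ S(A,x)\ge (\sqrt{2}-\epsilon)\sqrt{x}. \]
   Context: $\mathbb{N}_0$ denotes the set of nonnegative integers. A subset of $\mathbb{N}_0$ is 3-free if it contains no three-term arithmetic progression. Given a finite 3-free set $A=\{a_1,\dots,a_t\}\subset\mathbb{N}_0$ with $a_1<\dots<a_t$, the Stanley sequence generated by $A$ is the infinite sequence $S(A)=\{a_1,a_2,a_3,\dots\}$ defined recursively: for $k\ge t$, once $a_1<\dots<a_k$ are defined, $a_{k+1}$ is the smallest integer $a>a_k$ such that $\{a_1,\dots,a_k\}\cup\{a\}$ is 3-free. *)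

theory Defs
  imports Complex_Main
begin

definition three_free :: "nat set \<Rightarrow> bool" where
  "three_free A \<longleftrightarrow> \<not> (\<exists>a d. 0 < d \<and> a \<in> A \<and> a + d \<in> A \<and> a + 2 * d \<in> A)"

definition stanley_next :: "nat set \<Rightarrow> nat" where
  "stanley_next F = (LEAST a. (\<forall>s\<in>F. s < a) \<and> three_free (insert a F))"

text \<open>For finite 3-free \<open>F\<close> the set minimised over is nonempty, so the \<open>LEAST\<close> is meaningful.\<close>

lemma stanley_next_spec:
  assumes "finite F" "three_free F"
  shows "\<forall>s\<in>F. s < stanley_next F" "three_free (insert (stanley_next F) F)"
proof -
  let ?P = "\<lambda>a. (\<forall>s\<in>F. s < a) \<and> three_free (insert a F)"
  obtain m where m: "\<And>s. s \<in> F \<Longrightarrow> s \<le> m"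
    using assms(1) by (meson finite_nat_set_iff_bounded_le)
  have "three_free (insert (2 * m + 1) F)"
    unfolding three_free_def
  proof (intro notI, elim exE conjE)
    fix a d :: nat
    assume d: "0 < d" and in3: "a \<in> insert (2 * m + 1) F" "a + d \<in> insert (2 * m + 1) F"
      "a + 2 * d \<in> insert (2 * m + 1) F"
    have le: "a + 2 * d \<le> 2 * m + 1" using in3(3) m by fastforce
    have "a \<in> F" "a + d \<in> F" using in3(1,2) le d by auto
    moreover from this have "a + 2 * d \<noteq> 2 * m + 1" using m[of "a + d"] by linarith
    ultimately show False using in3(3) assms(2) d unfolding three_free_def by auto
  qed
  moreover have "\<forall>s\<in>F. s < 2 * m + 1" using m by fastforce
  ultimately have "?P (2 * m + 1)" by blast
  then have "?P (stanley_next F)" unfolding stanley_next_def by (rule LeastI)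
  then show "\<forall>s\<in>F. s < stanley_next F" "three_free (insert (stanley_next F) F)" by auto
qed

text \<open>\<open>stanley_stage A n\<close> is \<open>{a\<^sub>1, \<dots>, a\<^sub>k}\<close> with \<open>k = card A + n\<close>.  The construction also makes
  sense for \<open>A = {}\<close>, where the first element chosen is 0, so that \<open>S({}) = S({0})\<close>.\<close>

primrec stanley_stage :: "nat set \<Rightarrow> nat \<Rightarrow> nat set" where
  "stanley_stage A 0 = A"
| "stanley_stage A (Suc n) = insert (stanley_next (stanley_stage A n)) (stanley_stage A n)"

definition stanley :: "nat set \<Rightarrow> nat set" where
  "stanley A = (\<Union>n. stanley_stage A n)"

definition stanley_count :: "nat set \<Rightarrow> real \<Rightarrow> nat" where
  "stanley_count A x = card {s \<in> stanley A. real s \<le> x}"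

end

theory Submission
  imports Defs
begin

text \<open>Every integer beyond \<open>max A\<close> that the greedy rule skips is the last term \<open>2b - a\<close> of a progression
  whose first two terms \<open>a < b\<close> belong to the sequence. If \<open>c\<close> terms are at most \<open>x\<close>, at most
  \<open>c(c - 1)/2\<close> integers up to \<open>x\<close> are skipped, so \<open>x - O(1) \<le> c + c(c - 1)/2 \<le> (c + 1)\<^sup>2/2\<close>.\<close>

lemma finite_stanley_stage:
  assumes "finite A"
  shows "finite (stanley_stage A n)"
  by (induction n) (use assms in auto)

lemma three_free_stanley_stage:
  assumes "finite A" "three_free A"
  shows "three_free (stanley_stage A n)"
  by (induction n) (use assms stanley_next_spec(2) finite_stanley_stage in auto)

lemma stanley_stage_subset: "stanley_stage A n \<subseteq> stanley A"
  by (auto simp: stanley_def)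

text \<open>Each new term exceeds all earlier ones, so the maximum grows by at least 1 per step.
  Stage \<open>Suc n\<close> rather than \<open>n\<close> is used because stage 0 is empty when
  \<open>A\<close> is.\<close>

lemma stanley_stage_unbounded:
  assumes "finite A" "three_free A"
  shows "\<exists>s\<in>stanley_stage A (Suc n). n \<le> s"
proof (induction n)
  case 0
  show ?case by auto
next
  case (Suc n)
  then obtain s where s: "s \<in> stanley_stage A (Suc n)" "n \<le> s" by blast
  have "s < stanley_next (stanley_stage A (Suc n))"
    using stanley_next_spec(1)[OF finite_stanley_stage[OF assms(1)] three_free_stanley_stage[OF assms]]
      s(1) by (rule bspec)
  with s(2) have "Suc n \<le> stanley_next (stanley_stage A (Suc n))" by simp
  then show ?case by (subst stanley_stage.simps(2)) blast
qed

text \<open>By minimality of \<open>stanley_next F\<close>, adding \<open>n\<close> must create a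
  progression. As \<open>F\<close> is 3-free, \<open>n\<close> is one of its terms, and being larger
  than all of \<open>F\<close> it is the last. Since \<open>a < b\<close>, the natural subtraction
  is not truncated.\<close>

lemma skipped_progression:
  assumes "three_free F" "\<forall>s\<in>F. s < n" "n < stanley_next F"
  shows "\<exists>a\<in>F. \<exists>b\<in>F. a < b \<and> n = 2 * b - a"
proof -
  have "\<not> three_free (insert n F)"
    using assms not_less_Least unfolding stanley_next_def by blast
  then obtain a d where d: "0 < d" and ins: "a \<in> insert n F" "a + d \<in> insert n F"
      "a + 2 * d \<in> insert n F"
    unfolding three_free_def by blast
  have "a + 2 * d \<le> n" using ins(3) assms(2) by fastforce
  then have F: "a \<in> F" "a + d \<in> F" using ins(1,2) d by auto
  then have "a + 2 * d = n" using ins(3) assms(1) d unfolding three_free_def by blast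
  then have "n = 2 * (a + d) - a" by simp
  with F d show ?thesis by (metis less_add_same_cancel1)
qed

text \<open>The induction goes back to the first stage having an element beyond \<open>n\<close>:
  the term added there jumped over \<open>n\<close>.\<close>

lemma stanley_stage_progression:
  assumes "finite A" "three_free A" "\<forall>a\<in>A. a < n"
    and "s \<in> stanley_stage A k" "n < s" "n \<notin> stanley_stage A k"
  shows "\<exists>a\<in>stanley_stage A k. \<exists>b\<in>stanley_stage A k. a < b \<and> n = 2 * b - a"
  using assms(4-6)
proof (induction k arbitrary: s)
  case 0
  then show ?case using assms(3) by force
next
  case (Suc k)
  let ?F = "stanley_stage A k"
  have "\<exists>a\<in>?F. \<exists>b\<in>?F. a < b \<and> n = 2 * b - a"
  proof (cases "\<exists>t\<in>?F. n < t")
    case True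
    then show ?thesis using Suc.IH Suc.prems(3) by auto
  next
    case False
    \<comment> \<open>No element of \<open>?F\<close> passes \<open>n\<close>, so the
      \<open>s > n\<close> of the larger stage is the newly added term.\<close>
    then have "\<forall>t\<in>?F. t < n" using Suc.prems(3) by (auto simp: not_less le_less)
    moreover have "n < stanley_next ?F" using Suc.prems False by auto
    ultimately show ?thesis
      using skipped_progression three_free_stanley_stage[OF assms(1,2)] by blast
  qed
  then show ?case by auto
qed

lemma stanley_progression:
  assumes "finite A" "three_free A" "\<forall>a\<in>A. a < n" "n \<notin> stanley A"
  shows "\<exists>a\<in>stanley A. \<exists>b\<in>stanley A. a < b \<and> n = 2 * b - a"
proof -
  obtain s where "s \<in> stanley_stage A (Suc (Suc n))" "n < s"
    using stanley_stage_unbounded[OF assms(1,2), of "Suc n"] by (auto simp del: stanley_stage.simps)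
  then show ?thesis
    using stanley_stage_progression[OF assms(1-3)] assms(4) stanley_stage_subset by (meson subsetD)
qed

text \<open>The square \<open>T \<times> T\<close> splits into increasing pairs, decreasing pairs
  and the diagonal; swapping coordinates matches the first two.\<close>

lemma card_ordered_pairs:
  fixes T :: "'a::linorder set"
  assumes "finite T"
  shows "2 * card {(a, b). a \<in> T \<and> b \<in> T \<and> a < b} + card T = card T * card T"
proof -
  let ?P = "{(a, b). a \<in> T \<and> b \<in> T \<and> a < b}" and ?Q = "{(a, b). a \<in> T \<and> b \<in> T \<and> b < a}"
  have fin: "finite ?P" "finite ?Q" "finite (Id_on T)"
    by (rule finite_subset[of _ "T \<times> T"]; use assms in auto)+
  have "?Q = prod.swap ` ?P" by auto
  then have Q: "card ?Q = card ?P" by (simp add: card_image)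
  have "Id_on T = (\<lambda>a. (a, a)) ` T" by auto
  then have I: "card (Id_on T) = card T" by (simp add: card_image inj_on_def)
  have "T \<times> T = (?P \<union> ?Q) \<union> Id_on T"
    by (auto simp: Id_on_iff intro: linorder_cases)
  then have "card (T \<times> T) = card ((?P \<union> ?Q) \<union> Id_on T)" by simp
  also have "\<dots> = card (?P \<union> ?Q) + card (Id_on T)"
    by (rule card_Un_disjoint) (use fin in auto)
  also have "card (?P \<union> ?Q) = card ?P + card ?Q"
    by (rule card_Un_disjoint) (use fin in auto)
  finally show ?thesis using Q I by (simp add: card_cartesian_product)
qed

text \<open>In the loss \<open>Suc m\<close>, \<open>m\<close> pays for the integers up to
  \<open>m\<close>, where the greedy rule may not apply, and 1 for rounding \<open>x\<close>
  down.\<close>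

lemma stanley_count_bound:
  assumes "finite A" "three_free A" "\<forall>a\<in>A. a \<le> m"
  shows "2 * (x - real (Suc m)) \<le> (real (stanley_count A x) + 1)\<^sup>2"
proof -
  define T where "T = {s \<in> stanley A. real s \<le> x}"
  let ?P = "{(a, b). a \<in> T \<and> b \<in> T \<and> a < b}"
  let ?N = "nat \<lfloor>x\<rfloor>"
  have finT: "finite T"
    by (rule finite_subset[of _ "{..?N}"]) (auto simp: T_def le_nat_floor)
  have finP: "finite ?P"
    by (rule finite_subset[of _ "T \<times> T"]) (use finT in auto)
  have "{m<..?N} \<subseteq> T \<union> (\<lambda>(a, b). 2 * b - a) ` ?P"
  proof
    fix n assume n: "n \<in> {m<..?N}"
    then have x: "real n \<le> x" by simp linarith
    show "n \<in> T \<union> (\<lambda>(a, b). 2 * b - a) ` ?P"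
    proof (cases "n \<in> stanley A")
      case True
      then show ?thesis using x by (simp add: T_def)
    next
      case False
      moreover have "\<forall>a\<in>A. a < n" using assms(3) n by fastforce
      ultimately obtain a b where ab: "a \<in> stanley A" "b \<in> stanley A" "a < b" "n = 2 * b - a"
        using stanley_progression[OF assms(1,2)] by blast
      \<comment> \<open>From \<open>a < b\<close> follows \<open>b < 2 * b - a = n\<close>, so both
        terms are already counted in \<open>T\<close>.\<close>
      then have "real a \<le> x" "real b \<le> x" using x by auto
      then have "(a, b) \<in> ?P" using ab by (simp add: T_def)
      then show ?thesis using ab(4) by force
    qed
  qed
  then have "card {m<..?N} \<le> card (T \<union> (\<lambda>(a, b). 2 * b - a) ` ?P)"
    using finT finP by (intro card_mono) auto
  also have "\<dots> \<le> card T + card ?P"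
    by (rule order_trans[OF card_Un_le add_left_mono[OF card_image_le[OF finP]]])
  finally have "2 * (?N - m) \<le> card T * card T + card T"
    using card_ordered_pairs[OF finT] by simp
  then have "real (2 * (?N - m)) \<le> real (card T * card T + card T)"
    by (rule of_nat_mono)
  moreover have "x - real (Suc m) \<le> real (?N - m)" by linarith
  ultimately have "2 * (x - real (Suc m)) \<le> real (card T) * real (card T) + real (card T)"
    by simp
  \<comment> \<open>Passing to a perfect square lets a square root be taken later, at the cost of a
    bounded error.\<close>
  also have "\<dots> \<le> (real (card T) + 1)\<^sup>2" by (simp add: power2_eq_square algebra_simps)
  finally show ?thesis by (simp add: T_def stanley_count_def)
qed

theorem theorem1:
  fixes A :: "nat set"
  assumes "finite A" and "three_free A"
  shows "\<forall>\<epsilon>::real. \<epsilon> > 0 \<longrightarrow>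
           (\<exists>x0::real. \<forall>x::real. x \<ge> x0 \<longrightarrow> real (stanley_count A x) \<ge> (sqrt 2 - \<epsilon>) * sqrt x)"
proof (intro allI impI)
  fix \<epsilon> :: real assume \<epsilon>: "\<epsilon> > 0"
  obtain m where m: "\<forall>a\<in>A. a \<le> m"
    using assms(1) by (meson finite_nat_set_iff_bounded_le)
  define K where "K = real (Suc m)"
  \<comment> \<open>\<open>B\<close> is the total loss against \<open>sqrt 2 * sqrt x\<close>: the
    first summand comes from replacing \<open>x - K\<close> by \<open>x\<close> under the root, the
    1 from the count plus one in the bound.\<close>
  define B where "B = sqrt 2 * sqrt K + 1"
  have "K > 0" by (simp add: K_def)
  show "\<exists>x0. \<forall>x\<ge>x0. real (stanley_count A x) \<ge> (sqrt 2 - \<epsilon>) * sqrt x"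
  proof (intro exI allI impI)
    \<comment> \<open>\<open>K \<le> x\<close> makes \<open>x - K\<close> nonnegative for
      subadditivity of the root; the other threshold makes \<open>\<epsilon> * sqrt x\<close> absorb
      \<open>B\<close>.\<close>
    fix x assume x: "x \<ge> max K ((B / \<epsilon>)\<^sup>2)"
    then have "B / \<epsilon> \<le> sqrt x" by (intro real_le_rsqrt) simp
    then have B: "B \<le> \<epsilon> * sqrt x" using \<epsilon> by (simp add: field_simps)
    have "sqrt x \<le> sqrt (x - K) + sqrt K"
      using sqrt_add_le_add_sqrt[of "x - K" K] x \<open>K > 0\<close> by simp
    then have "sqrt 2 * sqrt x \<le> sqrt 2 * (sqrt (x - K) + sqrt K)"
      by (intro mult_left_mono) auto
    moreover have "sqrt 2 * sqrt (x - K) \<le> real (stanley_count A x) + 1"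
      using stanley_count_bound[OF assms m, of x]
      by (simp add: K_def real_sqrt_mult[symmetric] real_le_lsqrt)
    ultimately show "real (stanley_count A x) \<ge> (sqrt 2 - \<epsilon>) * sqrt x"
      using B by (simp add: B_def algebra_simps)
  qed
qed

end
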